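(* For integers $i \ge 0$ and $j$, let $f(i,j)$ denote the number of permutations of $\{0,1,\dots,i-1\}$ having exactly $j$ type 4 adjacencies (with $f(i,j)=0$ whenever $j<0$ or $j>i+1$). Then for every $i\ge 3$ and every $0\le j\le i+1$, $$\begin{aligned} f(i,j) ={}& (i-j-2)\big(f(i-1,j)-f(i-2,j-1)\big) \\ &+ 2\big(f(i-1,j-1)-f(i-2,j-2)\big) + f(i-2,j-2) \\ &+ (j+1)\big(f(i-1,j+1)-f(i-2,j)\big) + (i-j-1)\, f(i-2,j) + (j+1)\, f(i-2,j+1).\end{aligned}$$
   Context: A permutation of $\{0,1,\dots,n-1\}$ is written as a sequence $\pi=(\pi_1,\dots,\pi_n)$ in which each symbol occurs exactly once. The type 4 adjacencies (front-and-back adjacencies) of $\pi$ are: each index $i\in\{1,\dots,n-1\}$ with $\pi_{i+1}=\pi_i+1$; one more adjacency if $\pi_n=n-1$ (adjacent to an imagined $\pi_{n+1}=n$); and one more adjacency if $\pi_1=0$ (adjacent to an imagined $\pi_0=-1$). Thus a permutation of $\{0,\dots,n-1\}$ has between $0$ and $n+1$ type 4 adjacencies. *)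

theory Defs
  imports Complex_Main "HOL-Combinatorics.Multiset_Permutations"
begin

text \<open>A permutation of \<open>{0, \<dots>, n - 1}\<close> in one-line notation is an element of
  \<open>permutations_of_set {0..<n}\<close>. Lists are indexed from 0, so the index \<open>k\<close> below
  stands for position \<open>k + 1\<close> of the permutation. The last two summands are the adjacencies with the imagined entries
  \<open>n\<close> at the back and \<open>-1\<close> at the front; for the empty list no adjacency is counted.\<close>

definition type4_adjacencies :: "nat list \<Rightarrow> nat" where
  "type4_adjacencies xs =
     card {k. Suc k < length xs \<and> xs ! Suc k = xs ! k + 1}
     + (if xs \<noteq> [] \<and> last xs = length xs - 1 then 1 else 0)
     + (if xs \<noteq> [] \<and> hd xs = 0 then 1 else 0)"

definition f :: "nat \<Rightarrow> int \<Rightarrow> int" where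
  "f i j = int (card {xs \<in> permutations_of_set {0..<i}. int (type4_adjacencies xs) = j})"

lemma type4_adjacencies_le: "type4_adjacencies xs \<le> length xs + 1"
proof (cases xs)
  case Nil
  then show ?thesis by (simp add: type4_adjacencies_def)
next
  case (Cons a ys)
  have "card {k. Suc k < length xs \<and> xs ! Suc k = xs ! k + 1} \<le> card {..<length ys}"
    by (rule card_mono) (auto simp: Cons)
  moreover have "length xs = length ys + 1" by (simp add: Cons)
  ultimately show ?thesis unfolding type4_adjacencies_def by auto
qed

lemma f_eq_0: "f i j = 0" if "j < 0 \<or> j > int i + 1"
proof -
  have "int (type4_adjacencies xs) \<noteq> j" if "xs \<in> permutations_of_set {0..<i}" for xs
  proof -
    have "length xs = i"
      using that by (simp add: length_finite_permutations_of_set)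
    then show ?thesis
      using type4_adjacencies_le[of xs] \<open>j < 0 \<or> j > int i + 1\<close> by linarith
  qed
  then have "{xs \<in> permutations_of_set {0..<i}. int (type4_adjacencies xs) = j} = {}"
    by blast
  then show ?thesis unfolding f_def by simp
qed

end

theory Submission
  imports Defs
begin

text \<open>Every permutation of \<open>{0, \<dots>, m}\<close> arises from exactly one permutation \<open>xs\<close> of
  \<open>{0, \<dots>, m - 1}\<close> by inserting \<open>m\<close>. Inserting it at the back adds one adjacency.
  Inserting it in any other gap destroys the adjacency with the imagined entry at the back, if
  there is one, and the adjacency at the gap, if there is one, and creates an adjacency precisely
  when the gap is just behind \<open>m - 1\<close>. So the recurrence follows by counting gaps, separately for
  the \<open>xs\<close> ending in \<open>m - 1\<close>; those correspond to the permutations of \<open>{0, \<dots>, m - 2}\<close> with one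
  adjacency less.\<close>

section \<open>Adjacencies as gaps of a padded word\<close>

definition succ_gaps :: "nat list \<Rightarrow> nat set" where
  "succ_gaps w = {k. Suc k < length w \<and> w ! Suc k = w ! k + 1}"

lemma finite_succ_gaps [simp]: "finite (succ_gaps w)"
  by (rule finite_subset[of _ "{..<length w}"]) (auto simp: succ_gaps_def)

lemma succ_gaps_short [simp]: "succ_gaps [] = {}" "succ_gaps [a] = {}"
  by (auto simp: succ_gaps_def)

lemma succ_gaps_map_Suc [simp]: "succ_gaps (map Suc w) = succ_gaps w"
  by (auto simp: succ_gaps_def)

lemma card_succ_gaps_Cons:
  assumes "w \<noteq> []"
  shows "card (succ_gaps (a # w)) = of_bool (hd w = a + 1) + card (succ_gaps w)"
proof -
  have "succ_gaps (a # w) = (if hd w = a + 1 then {0} else {}) \<union> Suc ` succ_gaps w"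
  proof (rule set_eqI)
    fix k
    show "k \<in> succ_gaps (a # w) \<longleftrightarrow>
        k \<in> (if hd w = a + 1 then {0} else {}) \<union> Suc ` succ_gaps w"
      using assms by (cases k) (auto simp: succ_gaps_def hd_conv_nth)
  qed
  then show ?thesis
    by (auto simp: card_image)
qed

lemma card_succ_gaps_append:
  assumes "u \<noteq> []" "v \<noteq> []"
  shows "card (succ_gaps (u @ v)) =
    card (succ_gaps u) + of_bool (hd v = last u + 1) + card (succ_gaps v)"
  using assms(1)
proof (induction u rule: list_nonempty_induct)
  case (single a)
  then show ?case using assms(2) by (simp add: card_succ_gaps_Cons)
next
  case (cons a u)
  then show ?case by (simp add: card_succ_gaps_Cons)
qed

text \<open>Raising all entries by one turns the imagined front entry \<open>-1\<close> into the
  natural number \<open>0\<close>, so the front adjacency becomes an ordinary gap. The back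
  adjacency stays separate, since insertions before the end treat it differently.\<close>

lemma type4_adjacencies_eq:
  assumes "xs \<noteq> []"
  shows "type4_adjacencies xs =
    card (succ_gaps (0 # map Suc xs)) + of_bool (last xs = length xs - 1)"
  using assms
  by (simp add: type4_adjacencies_def card_succ_gaps_Cons hd_map succ_gaps_def[of xs])

text \<open>With the raised back entry appended as well, all adjacencies are gaps of one word, which
  \<open>card_succ_gaps_append\<close> can cut at any place.\<close>

lemma type4_adjacencies_eq':
  assumes "xs \<noteq> []"
  shows "type4_adjacencies xs = card (succ_gaps (0 # map Suc xs @ [Suc (length xs)]))"
proof -
  have "card (succ_gaps ((0 # map Suc xs) @ [Suc (length xs)])) =
    card (succ_gaps (0 # map Suc xs)) + of_bool (last xs = length xs - 1)"
    using assms by (subst card_succ_gaps_append) (auto simp: last_map)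
  then show ?thesis using assms by (simp add: type4_adjacencies_eq)
qed

section \<open>Insertion of the largest entry as a bijection\<close>

definition insert_at :: "nat \<Rightarrow> 'a \<Rightarrow> 'a list \<Rightarrow> 'a list" where
  "insert_at p x xs = take p xs @ x # drop p xs"

abbreviation perms :: "nat \<Rightarrow> nat list set" where
  "perms n \<equiv> permutations_of_set {0..<n}"

lemma perms_iff: "xs \<in> perms n \<longleftrightarrow> distinct xs \<and> set xs = {0..<n}"
  by (auto simp: permutations_of_set_def)

lemma perms_length: "xs \<in> perms n \<Longrightarrow> length xs = n"
  by (simp add: length_finite_permutations_of_set)

text \<open>As \<open>m\<close> does not occur in \<open>xs\<close>, its place in the result reveals
  \<open>p\<close>, and deleting it recovers \<open>xs\<close>.\<close>

lemma bij_betw_insert_at: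
  "bij_betw (\<lambda>(xs, p). insert_at p m xs) (perms m \<times> {..m}) (perms (Suc m))"
proof (rule bij_betwI')
  fix s t assume "s \<in> perms m \<times> {..m}" "t \<in> perms m \<times> {..m}"
  then obtain xs p ys q where st: "s = (xs, p)" "t = (ys, q)" "xs \<in> perms m" "ys \<in> perms m"
    "p \<le> m" "q \<le> m" by auto
  have notin: "m \<notin> set xs" "m \<notin> set ys" and len: "length xs = m" "length ys = m"
    using st by (auto simp: perms_iff perms_length)
  have "xs = ys \<and> p = q" if eq: "insert_at p m xs = insert_at q m ys"
  proof -
    have "take p xs = take q ys \<and> drop p xs = drop q ys"
      using eq notin
      by (subst (asm) insert_at_def, subst (asm) insert_at_def, subst (asm) append_Cons_eq_iff)
         (auto dest: in_set_takeD in_set_dropD)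
    \<comment> \<open>Since \<open>p\<close> and \<open>q\<close> are at most \<open>m\<close>, they
      are the lengths of the two prefixes.\<close>
    then show ?thesis
      using len st by (metis append_take_drop_id length_take min.absorb2)
  qed
  then show "(case s of (xs, p) \<Rightarrow> insert_at p m xs) = (case t of (xs, p) \<Rightarrow> insert_at p m xs)
      \<longleftrightarrow> s = t"
    using st by auto
next
  fix s assume "s \<in> perms m \<times> {..m}"
  then obtain xs p where s: "s = (xs, p)" "xs \<in> perms m" by auto
  then have xs: "distinct (take p xs @ drop p xs)" "set (take p xs @ drop p xs) = {0..<m}"
    by (auto simp: perms_iff)
  have "m \<notin> set xs" using s by (auto simp: perms_iff)
  then have "distinct (insert_at p m xs)"
    using xs(1) unfolding insert_at_def distinct_append
    by (auto dest: in_set_takeD in_set_dropD)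
  moreover have "set (insert_at p m xs) = insert m (set (take p xs @ drop p xs))"
    unfolding insert_at_def set_append list.set by blast
  ultimately show "(case s of (xs, p) \<Rightarrow> insert_at p m xs) \<in> perms (Suc m)"
    using s xs(2) by (auto simp: perms_iff)
next
  fix ys assume ys: "ys \<in> perms (Suc m)"
  then have "m \<in> set ys" by (simp add: perms_iff)
  then obtain u v where uv: "ys = u @ m # v" by (meson split_list)
  have "u @ v \<in> perms m"
  proof -
    have "distinct (u @ v)" "m \<notin> set (u @ v)" "insert m (set (u @ v)) = {0..<Suc m}"
      using ys uv by (auto simp: perms_iff)
    moreover from this have "set (u @ v) = {0..<Suc m} - {m}" by auto
    ultimately show ?thesis by (auto simp: perms_iff)
  qed
  moreover from this have "length u \<le> m" using perms_length by fastforce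
  ultimately show "\<exists>s \<in> perms m \<times> {..m}. ys = (case s of (xs, p) \<Rightarrow> insert_at p m xs)"
    by (intro bexI[of _ "(u @ v, length u)"]) (auto simp: uv insert_at_def)
qed

lemma card_perms_Suc:
  "card {ys \<in> perms (Suc m). P ys} = (\<Sum>xs\<in>perms m. card {p. p \<le> m \<and> P (insert_at p m xs)})"
proof -
  have image: "{y \<in> g ` S. P y} = g ` {s \<in> S. P (g s)}"
    for g :: "nat list \<times> nat \<Rightarrow> nat list" and S
    by blast
  have "bij_betw (\<lambda>(xs, p). insert_at p m xs)
      {s \<in> perms m \<times> {..m}. P (case s of (xs, p) \<Rightarrow> insert_at p m xs)}
      {ys \<in> perms (Suc m). P ys}"
    by (rule bij_betw_subset[OF bij_betw_insert_at])
       (use image[symmetric] bij_betw_imp_surj_on[OF bij_betw_insert_at[of m]] in auto)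
  then have "card {ys \<in> perms (Suc m). P ys} =
      card {s \<in> perms m \<times> {..m}. P (case s of (xs, p) \<Rightarrow> insert_at p m xs)}"
    by (simp add: bij_betw_same_card)
  also have "{s \<in> perms m \<times> {..m}. P (case s of (xs, p) \<Rightarrow> insert_at p m xs)} =
      (SIGMA xs:perms m. {p. p \<le> m \<and> P (insert_at p m xs)})" by auto
  also have "card \<dots> = (\<Sum>xs\<in>perms m. card {p. p \<le> m \<and> P (insert_at p m xs)})"
    by (rule card_SigmaI) auto
  finally show ?thesis .
qed

section \<open>Effect of one insertion on the adjacencies\<close>

lemma type4_adjacencies_snoc:
  assumes "xs \<in> perms m" "m > 0"
  shows "type4_adjacencies (xs @ [m]) = type4_adjacencies xs + 1"
proof -
  have len: "length xs = m" using assms perms_length by auto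
  then have ne: "xs \<noteq> []" using assms by auto
  \<comment> \<open>The old imagined back entry becomes the real entry \<open>m\<close>, and the
    only new gap is the one before the new imagined entry. For \<open>m = 0\<close> this fails:
    \<open>[]\<close> counts no adjacency, \<open>[0]\<close> counts two.\<close>
  have "type4_adjacencies (xs @ [m]) =
      card (succ_gaps ((0 # map Suc xs @ [Suc (length xs)]) @ [Suc (Suc (length xs))]))"
    using len by (subst type4_adjacencies_eq') auto
  also have "\<dots> = type4_adjacencies xs + 1"
    using ne by (subst card_succ_gaps_append) (auto simp: type4_adjacencies_eq')
  finally show ?thesis .
qed

text \<open>\<open>w\<close> is padded only at the front, so its gaps omit the back adjacency, which
  cannot survive the insertion. As entries are raised by one, \<open>w ! p = m\<close> says that
  \<open>m - 1\<close> stands just before the insertion place.\<close>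

lemma type4_adjacencies_insert_at:
  assumes xs: "xs \<in> perms m" and p: "p < m"
  defines "w \<equiv> 0 # map Suc xs"
  shows "int (type4_adjacencies (insert_at p m xs)) =
    int (card (succ_gaps w)) - of_bool (p \<in> succ_gaps w) + of_bool (w ! p = m)"
proof -
  have len: "length xs = m" using xs perms_length by auto
  then have ne: "xs \<noteq> []" using p by auto
  have lt: "x < m" if "x \<in> set xs" for x using xs that by (auto simp: perms_iff)
  define u v where "u = take (Suc p) w" and "v = drop (Suc p) w"
  have lw: "length w = Suc m" by (simp add: w_def len)
  have uv: "u \<noteq> []" "v \<noteq> []" "w = u @ v" "hd v = w ! Suc p"
    using lw p by (auto simp: u_def v_def hd_drop_conv_nth)
  have "u = take p w @ [w ! p]"
    unfolding u_def using lw p by (intro take_Suc_conv_app_nth) simp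
  then have last_u: "last u = w ! p" by simp
  have "hd v \<in> set v" "last v \<in> set v" using uv(2) by simp_all
  moreover have "set v \<subseteq> Suc ` set xs"
    by (auto simp: v_def w_def drop_map dest: in_set_dropD)
  \<comment> \<open>These bounds exclude an adjacency of the inserted \<open>Suc m\<close> with
    \<open>hd v\<close>, and one of \<open>last v\<close> with the back entry
    \<open>Suc (Suc m)\<close>.\<close>
  ultimately have v: "hd v \<le> m" "last v \<le> m" using lt by fastforce+
  have w: "card (succ_gaps w) =
      card (succ_gaps u) + of_bool (p \<in> succ_gaps w) + card (succ_gaps v)"
  proof -
    have "p \<in> succ_gaps w \<longleftrightarrow> hd v = last u + 1"
      using lw p unfolding uv(4) last_u by (simp add: succ_gaps_def)
    then show ?thesis
      using card_succ_gaps_append[OF uv(1,2)] unfolding uv(3) by simp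
  qed
  have "type4_adjacencies (insert_at p m xs) =
      card (succ_gaps (u @ [Suc m] @ v @ [Suc (Suc m)]))"
    by (subst type4_adjacencies_eq')
       (auto simp: insert_at_def u_def v_def w_def len take_map drop_map p less_imp_le)
  also have "\<dots> = card (succ_gaps u) + of_bool (w ! p = m) + card (succ_gaps v)"
    using uv(1,2) last_u v by (simp add: card_succ_gaps_append card_succ_gaps_Cons)
  finally show ?thesis using w by simp
qed

text \<open>The first summand is insertion at the back. The other coefficients are the numbers of
  remaining gaps that lose, gain or keep adjacencies. If \<open>xs\<close> ends in
  \<open>m - 1\<close>, no such gap gains one, and the lost back adjacency shifts the conditions on
  \<open>t\<close>.\<close>

lemma int_card_insert_at:
  fixes j :: int
  assumes xs: "xs \<in> perms m" and m: "m > 0"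
  defines "t \<equiv> int (type4_adjacencies xs)"
  shows "int (card {p. p \<le> m \<and> int (type4_adjacencies (insert_at p m xs)) = j}) =
    of_bool (t = j - 1) +
    (if last xs = m - 1
     then (j + 1) * of_bool (t = j + 2) + (int m - j) * of_bool (t = j + 1)
     else (j + 1) * of_bool (t = j + 1) + of_bool (t = j - 1)
        + (int m - 1 - j) * of_bool (t = j))"
proof -
  define w where "w = 0 # map Suc xs"
  \<comment> \<open>\<open>A\<close> collects the gap just behind \<open>m - 1\<close>, unless that
    is the back gap; \<open>B\<close> collects the gaps with an adjacency, the front one included;
    \<open>s\<close> omits the back adjacency.\<close>
  define A where "A = {p. p < m \<and> w ! p = m}"
  define B where "B = succ_gaps w"
  define s where "s = int (card B)"
  have len: "length xs = m" using xs perms_length by auto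
  then have ne: "xs \<noteq> []" using m by auto
  have lw: "length w = Suc m" by (simp add: w_def len)
  have t: "t = s + of_bool (last xs = m - 1)"
    using type4_adjacencies_eq[OF ne] len by (simp add: t_def s_def B_def w_def)
  have dw: "distinct w" using xs by (auto simp: w_def perms_iff distinct_map)
  have le: "x \<le> m" if "x \<in> set w" for x using xs that by (auto simp: w_def perms_iff)
  have wm: "w ! m = Suc (last xs)"
    using len ne m by (simp add: w_def last_conv_nth nth_Cons')
  have cA: "int (card A) = of_bool (last xs \<noteq> m - 1)"
  proof -
    have "m \<in> set w" using xs m by (cases m) (auto simp: w_def perms_iff)
    then obtain q where q: "q \<le> m" "w ! q = m" using lw by (metis in_set_conv_nth less_Suc_eq_le)
    have uniq: "p = q" if "p \<le> m" "w ! p = m" for p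
    proof -
      have "w ! p = w ! q" using that(2) q(2) by (rule trans[OF _ sym])
      then show ?thesis using nth_eq_iff_index_eq[OF dw, of p q] that(1) q(1) lw by simp
    qed
    have "q = m \<longleftrightarrow> last xs = m - 1"
      using q wm m uniq[of m] by auto
    then have "A = (if last xs = m - 1 then {} else {q})"
    proof -
      have "A \<subseteq> {q}" using uniq by (simp add: A_def subset_iff)
      moreover have "q \<in> A \<longleftrightarrow> q \<noteq> m"
        using q unfolding A_def mem_Collect_eq le_less by blast
      ultimately show ?thesis using \<open>q = m \<longleftrightarrow> last xs = m - 1\<close> by (cases "q \<in> A") auto
    qed
    then show ?thesis by simp
  qed
  have subAB: "A \<subseteq> {..<m}" "B \<subseteq> {..<m}" using lw by (auto simp: A_def B_def succ_gaps_def)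
  then have finAB: "finite A" "finite B" by (auto intro: finite_subset)
  have disj: "A \<inter> B = {}"
  proof -
    \<comment> \<open>A gap in both sets would put \<open>Suc m\<close> behind the entry
      \<open>m\<close>, but entries of \<open>w\<close> are at most \<open>m\<close>.\<close>
    have "w ! Suc p \<noteq> Suc m" if "p < m" for p
      using le[of "w ! Suc p"] that lw by (metis Suc_less_eq Suc_n_not_le_n nth_mem)
    then show ?thesis by (auto simp: A_def B_def succ_gaps_def)
  qed
  have ins: "int (type4_adjacencies (insert_at p m xs)) = s - of_bool (p \<in> B) + of_bool (p \<in> A)"
    if "p < m" for p
    using type4_adjacencies_insert_at[OF xs that] that by (simp add: s_def A_def B_def w_def)
  have insm: "int (type4_adjacencies (insert_at m m xs)) = t + 1"
    using type4_adjacencies_snoc[OF xs m] len by (simp add: insert_at_def t_def)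
  have "{p. p \<le> m \<and> int (type4_adjacencies (insert_at p m xs)) = j} =
      (if t = j - 1 then {m} else {}) \<union> {p. p < m \<and> s - of_bool (p \<in> B) + of_bool (p \<in> A) = j}"
    using ins insm by (auto simp: le_less)
  then have 1: "int (card {p. p \<le> m \<and> int (type4_adjacencies (insert_at p m xs)) = j}) =
      of_bool (t = j - 1) + int (card {p. p < m \<and> s - of_bool (p \<in> B) + of_bool (p \<in> A) = j})"
    by auto
  \<comment> \<open>Insertion gives \<open>s - 1\<close> on \<open>B\<close>, \<open>s + 1\<close>
    on \<open>A\<close> and \<open>s\<close> elsewhere, so a fixed \<open>j\<close> selects at most
    one class.\<close>
  have "{p. p < m \<and> s - of_bool (p \<in> B) + of_bool (p \<in> A) = j} =
      (if s = j + 1 then B else if s = j - 1 then A else if s = j then {..<m} - (A \<union> B) else {})"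
    using subAB disj by (auto split: if_splits)
  moreover have "int (card ({..<m} - (A \<union> B))) = int m - card A - card B"
  proof -
    have "card (A \<union> B) \<le> m" using card_mono[of "{..<m}" "A \<union> B"] subAB by auto
    moreover have "card ({..<m} - (A \<union> B)) = m - card (A \<union> B)"
      using subAB finAB by (subst card_Diff_subset) auto
    ultimately show ?thesis using card_Un_disjoint[OF finAB disj] by simp
  qed
  ultimately have 2: "int (card {p. p < m \<and> s - of_bool (p \<in> B) + of_bool (p \<in> A) = j}) =
      (j + 1) * of_bool (s = j + 1) + of_bool (last xs \<noteq> m - 1 \<and> s = j - 1)
      + (int m - of_bool (last xs \<noteq> m - 1) - j) * of_bool (s = j)"
    using cA s_def by auto
  show ?thesis unfolding 1 2 t by auto
qed

section \<open>Summation over all permutations\<close>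

lemma f_eq_sum: "f n j = (\<Sum>xs\<in>perms n. of_bool (int (type4_adjacencies xs) = j))"
  by (simp add: f_def sum.If_cases of_bool_def Int_def)

text \<open>Deleting the final entry \<open>m - 1\<close> removes exactly one adjacency;
  \<open>m \<ge> 2\<close> keeps the shorter permutation nonempty, as
  \<open>type4_adjacencies_snoc\<close> requires.\<close>

lemma sum_perms_last:
  assumes "m \<ge> 2"
  shows "(\<Sum>xs\<in>perms m. of_bool (last xs = m - 1 \<and> int (type4_adjacencies xs) = k)) =
    f (m - 1) (k - 1)"
proof -
  obtain n where n: "m = Suc n" "n > 0" using assms by (cases m) auto
  have mem: "ys @ [n] \<in> perms m \<longleftrightarrow> ys \<in> perms n" for ys
  proof -
    have "insert n (set ys) = {0..<Suc n} \<longleftrightarrow> set ys = {0..<n}" if "n \<notin> set ys"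
      using that by (auto simp: atLeast0_lessThan_Suc)
    then show ?thesis by (auto simp: perms_iff n)
  qed
  have "bij_betw (\<lambda>ys. ys @ [n]) {ys \<in> perms n. int (type4_adjacencies ys) = k - 1}
      {xs \<in> perms m. last xs = m - 1 \<and> int (type4_adjacencies xs) = k}"
  proof (rule bij_betwI')
    fix xs assume xs: "xs \<in> {xs \<in> perms m. last xs = m - 1 \<and> int (type4_adjacencies xs) = k}"
    then have "xs \<noteq> []" by (auto simp: perms_iff n)
    then have eq: "xs = butlast xs @ [n]" using xs n by (metis (mono_tags, lifting)
          append_butlast_last_id diff_Suc_1 mem_Collect_eq)
    then have bl: "butlast xs \<in> perms n" using xs mem by (metis (no_types, lifting) mem_Collect_eq)
    then have "int (type4_adjacencies (butlast xs)) = k - 1"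
      using xs type4_adjacencies_snoc[OF bl n(2)] eq by simp
    then show "\<exists>ys \<in> {ys \<in> perms n. int (type4_adjacencies ys) = k - 1}. xs = ys @ [n]"
      using bl eq by blast
  qed (use mem type4_adjacencies_snoc[OF _ n(2)] n in auto)
  then have "f n (k - 1) =
      int (card {xs \<in> perms m. last xs = m - 1 \<and> int (type4_adjacencies xs) = k})"
    by (simp add: f_def bij_betw_same_card)
  then show ?thesis using n by (simp add: sum.If_cases of_bool_def Int_def)
qed

theorem theorem3:
  fixes i :: nat and j :: int
  assumes "i \<ge> 3" and "0 \<le> j" and "j \<le> int i + 1"
  shows "f i j =
      (int i - j - 2) * (f (i - 1) j - f (i - 2) (j - 1))
    + 2 * (f (i - 1) (j - 1) - f (i - 2) (j - 2)) + f (i - 2) (j - 2)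
    + (j + 1) * (f (i - 1) (j + 1) - f (i - 2) j)
    + (int i - j - 1) * f (i - 2) j
    + (j + 1) * f (i - 2) (j + 1)"
proof -
  obtain m where m: "i = Suc m" "m \<ge> 2" using assms(1) by (cases i) auto
  \<comment> \<open>\<open>T\<close> detects all permutations with \<open>k\<close> adjacencies,
    \<open>L\<close> those that also end in \<open>m - 1\<close>; hence \<open>T - L\<close>
    expresses the other case of \<open>int_card_insert_at\<close> linearly.\<close>
  define T :: "int \<Rightarrow> nat list \<Rightarrow> int"
    where "T k xs = of_bool (int (type4_adjacencies xs) = k)" for k xs
  define L :: "int \<Rightarrow> nat list \<Rightarrow> int"
    where "L k xs = of_bool (last xs = m - 1 \<and> int (type4_adjacencies xs) = k)" for k xs
  have sumT: "sum (T k) (perms m) = f m k" for k by (simp add: T_def f_eq_sum)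
  have sumL: "sum (L k) (perms m) = f (m - 1) (k - 1)" for k
    unfolding L_def by (rule sum_perms_last[OF m(2)])
  have "f i j =
      (\<Sum>xs\<in>perms m. int (card {p. p \<le> m \<and> int (type4_adjacencies (insert_at p m xs)) = j}))"
    unfolding f_def m(1) by (simp add: card_perms_Suc)
  also have "\<dots> = (\<Sum>xs\<in>perms m. T (j - 1) xs + (j + 1) * L (j + 2) xs + (int m - j) * L (j + 1) xs
      + (j + 1) * (T (j + 1) xs - L (j + 1) xs) + (T (j - 1) xs - L (j - 1) xs)
      + (int m - 1 - j) * (T j xs - L j xs))"
    using m by (intro sum.cong refl, subst int_card_insert_at) (auto simp: T_def L_def)
  also have "\<dots> = f m (j - 1) + (j + 1) * f (m - 1) (j + 1) + (int m - j) * f (m - 1) j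
      + (j + 1) * (f m (j + 1) - f (m - 1) j) + (f m (j - 1) - f (m - 1) (j - 2))
      + (int m - 1 - j) * (f m j - f (m - 1) (j - 1))"
    by (simp add: sum.distrib sum_subtractf sumT sumL flip: sum_distrib_left) (simp add: add.commute)
  finally have "f i j = \<dots>" .
  moreover have "i - 1 = m" "i - 2 = m - 1" "int i = int m + 1" using m by auto
  \<comment> \<open>The term \<open>f m (j - 1)\<close> arises twice, from insertion at the back and
    behind \<open>m - 1\<close>, but only the latter subtracts \<open>f (m - 1) (j - 2)\<close>.
    Doubling the difference leaves the extra summand \<open>f (i - 2) (j - 2)\<close>.\<close>
  ultimately show ?thesis by (simp only:) (simp add: algebra_simps)
qed

end
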